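(* For any independence system $(A, M)$ on a finite nonempty ground set $A$ such that every $a \in A$ is contained in some $m \in M$, it holds that $p_U = p_R$.
   Context: A pair $(A,M)$, with $M$ a family of subsets of $A$, is an independence system if $\emptyset \in M$ and for every $m \in M$ and every $m' \subseteq m$ we have $m' \in M$. For $a \in A$, write $M_a = \{m \in M : a \in m\}$. The uniform fairness $p_U$ of $(A,M)$ is the optimal value of the linear program: maximize $p$ subject to $\sum_{m \in M_a} x_m = p$ for all $a \in A$, $\sum_{m \in M} x_m = 1$, $x_m \ge 0$ for all $m \in M$, $p \in \mathbb{R}$. The Rawlsian justice $p_R$ of $(A,M)$ is the optimal value of the linear program obtained by replacing the constraints $\sum_{m \in M_a} x_m = p$ by $\sum_{m \in M_a} x_m \ge p$ for all $a \in A$. *)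

theory Defs
  imports "HOL-Library.Extended_Real"
begin

definition independence_system :: "'a set \<Rightarrow> 'a set set \<Rightarrow> bool" where
  "independence_system A M \<longleftrightarrow>
     M \<subseteq> Pow A \<and> {} \<in> M \<and> (\<forall>m\<in>M. \<forall>m'. m' \<subseteq> m \<longrightarrow> m' \<in> M)"

definition members_containing :: "'a set set \<Rightarrow> 'a \<Rightarrow> 'a set set" where
  "members_containing M a = {m \<in> M. a \<in> m}"

text \<open>Only the values of a function \<open>x\<close> on \<open>M\<close> matter below; they are the LP variables
  \<open>x\<^sub>m\<close>. Sums are meant for finite \<open>M\<close>, which holds whenever \<open>A\<close> is finite.\<close>

definition is_distribution :: "'a set set \<Rightarrow> ('a set \<Rightarrow> real) \<Rightarrow> bool" where
  "is_distribution M x \<longleftrightarrow> (\<Sum>m\<in>M. x m) = 1 \<and> (\<forall>m\<in>M. 0 \<le> x m)"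

definition uniform_feasible ::
    "'a set \<Rightarrow> 'a set set \<Rightarrow> (('a set \<Rightarrow> real) \<times> real) set" where
  "uniform_feasible A M =
     {(x, p). is_distribution M x \<and> (\<forall>a\<in>A. (\<Sum>m\<in>members_containing M a. x m) = p)}"

definition rawlsian_feasible ::
    "'a set \<Rightarrow> 'a set set \<Rightarrow> (('a set \<Rightarrow> real) \<times> real) set" where
  "rawlsian_feasible A M =
     {(x, p). is_distribution M x \<and> (\<forall>a\<in>A. (\<Sum>m\<in>members_containing M a. x m) \<ge> p)}"

text \<open>Optimal values of maximisation problems are taken in the extended reals, so that the
  value is \<open>-\<infinity>\<close> for an infeasible and \<open>\<infinity>\<close> for an unbounded program.\<close>

definition uniform_fairness :: "'a set \<Rightarrow> 'a set set \<Rightarrow> ereal" where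
  "uniform_fairness A M = (SUP (x, p)\<in>uniform_feasible A M. ereal p)"

definition rawlsian_justice :: "'a set \<Rightarrow> 'a set set \<Rightarrow> ereal" where
  "rawlsian_justice A M = (SUP (x, p)\<in>rawlsian_feasible A M. ereal p)"

end

theory Submission
  imports Defs
begin

text \<open>
  A uniform solution is in particular a Rawlsian one, so only \<open>p\<^sub>R \<le> p\<^sub>U\<close> has content. Read a
  distribution on \<open>M\<close> as a random member of \<open>M\<close>; the constraints then speak about the
  probability that the random member contains \<open>a\<close>. Where this probability exceeds the
  guaranteed level \<open>p \<ge> 0\<close>, it can be lowered to exactly \<open>p\<close> by discarding \<open>a\<close> from the random
  member with a suitable probability: the result is still in \<open>M\<close> because \<open>M\<close> is closed under
  subsets, and no other element is affected (\<open>thin_element\<close>). Doing this for one element after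
  the other (\<open>level_coverage\<close>) turns a Rawlsian solution into a uniform one of the same value.
  A negative level \<open>p\<close> is beaten by level \<open>0\<close>, which is attained by choosing the empty set.
\<close>

definition coverage :: "'a set set \<Rightarrow> ('a set \<Rightarrow> real) \<Rightarrow> 'a \<Rightarrow> real" where
  "coverage M x a = (\<Sum>m\<in>members_containing M a. x m)"

text \<open>
  Coverage is an expectation, just as the total mass is, so a formula for the
  expectation of an arbitrary function determines both.
\<close>

lemma coverage_eq_expectation:
  assumes "finite M"
  shows "coverage M x a = (\<Sum>m\<in>M. of_bool (a \<in> m) * x m)"
  using assms by (simp add: coverage_def members_containing_def sum.If_cases
      of_bool_def if_distrib[of "\<lambda>c. c * _"] Int_def cong: if_cong)

lemma coverage_nonneg:
  assumes "is_distribution M x"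
  shows "0 \<le> coverage M x a"
  using assms by (auto simp: coverage_def is_distribution_def members_containing_def
      intro!: sum_nonneg)

text \<open>
  Law of the random set that is \<open>m\<close>, drawn from \<open>x\<close>, with probability \<open>t\<close> and \<open>m - {a}\<close>
  otherwise. Writing it as a mixture over \<open>m\<close> treats the sets with and without \<open>a\<close> alike, since
  both outcomes coincide when \<open>a \<notin> m\<close>.
\<close>

definition thin :: "'a set set \<Rightarrow> 'a \<Rightarrow> real \<Rightarrow> ('a set \<Rightarrow> real) \<Rightarrow> 'a set \<Rightarrow> real" where
  "thin M a t x k = (\<Sum>m\<in>M. x m * (t * of_bool (k = m) + (1 - t) * of_bool (k = m - {a})))"

text \<open>
  Closure under removal of \<open>a\<close> is what keeps all the mass of \<open>thin M a t x\<close> on \<open>M\<close>.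
\<close>

lemma expectation_thin:
  fixes f :: "'a set \<Rightarrow> real"
  assumes "finite M" and closed: "\<And>m. m \<in> M \<Longrightarrow> m - {a} \<in> M"
  shows "(\<Sum>k\<in>M. f k * thin M a t x k) = (\<Sum>m\<in>M. x m * (t * f m + (1 - t) * f (m - {a})))"
proof -
  have point: "(\<Sum>k\<in>M. f k * of_bool (k = n)) = f n" if "n \<in> M" for n
    using assms(1) that by (simp add: of_bool_def if_distrib[of "\<lambda>c. _ * c"] cong: if_cong)
  have "(\<Sum>k\<in>M. f k * thin M a t x k)
      = (\<Sum>k\<in>M. \<Sum>m\<in>M. x m * (t * (f k * of_bool (k = m))
                             + (1 - t) * (f k * of_bool (k = m - {a}))))"
    by (simp add: thin_def sum_distrib_left algebra_simps)
  also have "\<dots> = (\<Sum>m\<in>M. x m * (t * (\<Sum>k\<in>M. f k * of_bool (k = m))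
                             + (1 - t) * (\<Sum>k\<in>M. f k * of_bool (k = m - {a}))))"
    by (subst sum.swap) (simp only: sum.distrib sum_distrib_left[symmetric])
  also have "\<dots> = (\<Sum>m\<in>M. x m * (t * f m + (1 - t) * f (m - {a})))"
    by (intro sum.cong refl) (simp only: point closed)
  finally show ?thesis .
qed

lemma thin_element:
  assumes "finite M" and closed: "\<And>m. m \<in> M \<Longrightarrow> m - {a} \<in> M"
    and x: "is_distribution M x" and t: "0 \<le> t" "t \<le> 1"
  shows "is_distribution M (thin M a t x)"
    and "coverage M (thin M a t x) a = t * coverage M x a"
    and "b \<noteq> a \<Longrightarrow> coverage M (thin M a t x) b = coverage M x b"
proof -
  note expectation = expectation_thin[OF assms(1) closed]
  have "(\<Sum>k\<in>M. thin M a t x k) = 1"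
    using expectation[of "\<lambda>_. 1" t x] x by (simp add: is_distribution_def)
  moreover have "0 \<le> thin M a t x k" for k
    using x t by (auto simp: thin_def is_distribution_def intro!: sum_nonneg)
  ultimately show "is_distribution M (thin M a t x)"
    by (simp add: is_distribution_def)
  show "coverage M (thin M a t x) a = t * coverage M x a"
    by (simp add: coverage_eq_expectation[OF assms(1)] expectation sum_distrib_left algebra_simps)
  show "coverage M (thin M a t x) b = coverage M x b" if "b \<noteq> a"
    using that by (simp add: coverage_eq_expectation[OF assms(1)] expectation algebra_simps)
qed

text \<open>
  Since thinning at one element leaves the coverage of the others alone, the elements of \<open>B\<close> can
  be treated one at a time; the last conjunct keeps the coverage of the untreated elements at
  least \<open>p\<close> along the induction.
\<close>

lemma level_coverage:
  assumes "finite M" and closed: "\<And>m m'. m \<in> M \<Longrightarrow> m' \<subseteq> m \<Longrightarrow> m' \<in> M"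
    and x: "is_distribution M x" and "0 \<le> p"
    and "finite B" and "\<And>b. b \<in> B \<Longrightarrow> p \<le> coverage M x b"
  shows "\<exists>y. is_distribution M y \<and> (\<forall>b\<in>B. coverage M y b = p)
           \<and> (\<forall>b. b \<notin> B \<longrightarrow> coverage M y b = coverage M x b)"
  using assms(5,6)
proof (induction B)
  case empty
  then show ?case using x by auto
next
  case (insert a B)
  then obtain y where y: "is_distribution M y" "\<forall>b\<in>B. coverage M y b = p"
    "\<forall>b. b \<notin> B \<longrightarrow> coverage M y b = coverage M x b"
    by auto
  have above: "p \<le> coverage M y a"
    using insert y(3) by auto
  \<comment> \<open>If the coverage of \<open>a\<close> is \<open>0\<close>, then so is \<open>p\<close>, and the value \<open>t = 0 / 0 = 0\<close> is harmless.\<close>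
  define t where "t = p / coverage M y a"
  have t: "0 \<le> t" "t \<le> 1" "t * coverage M y a = p"
    using above \<open>0 \<le> p\<close> coverage_nonneg[OF y(1), of a] by (auto simp: t_def divide_le_eq_1)
  have "m - {a} \<in> M" if "m \<in> M" for m
    using closed that by blast
  note thinned = thin_element[OF assms(1) this y(1) t(1,2)]
  have "coverage M (thin M a t y) b = p" if "b \<in> insert a B" for b
    using that thinned(2) thinned(3)[of b] t(3) y(2) by (cases "b = a") auto
  moreover have "coverage M (thin M a t y) b = coverage M x b" if "b \<notin> insert a B" for b
    using that thinned(3)[of b] y(3) by auto
  ultimately show ?case
    using thinned(1) by blast
qed

lemma uniform_dominates_rawlsian:
  assumes "finite A" and "independence_system A M" and feasible: "(x, p) \<in> rawlsian_feasible A M"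
  shows "\<exists>y q. (y, q) \<in> uniform_feasible A M \<and> p \<le> q"
proof -
  have fin: "finite M"
    using assms(1,2) by (auto simp: independence_system_def intro: finite_subset)
  have closed: "m' \<in> M" if "m \<in> M" "m' \<subseteq> m" for m m'
    using assms(2) that by (auto simp: independence_system_def)
  have x: "is_distribution M x" "\<And>a. a \<in> A \<Longrightarrow> p \<le> coverage M x a"
    using feasible by (auto simp: rawlsian_feasible_def coverage_def)
  show ?thesis
  proof (cases "0 \<le> p")
    case True
    obtain y where "is_distribution M y" "\<forall>a\<in>A. coverage M y a = p"
      using level_coverage[of M x p A] fin closed x True assms(1) by blast
    then have "(y, p) \<in> uniform_feasible A M"
      by (auto simp: uniform_feasible_def coverage_def)
    then show ?thesis by blast
  next
    case False
    have "{} \<in> M"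
      using assms(2) by (simp add: independence_system_def)
    then have "((\<lambda>m. of_bool (m = {})), 0) \<in> uniform_feasible A M"
      using fin by (auto simp: uniform_feasible_def is_distribution_def members_containing_def
          of_bool_def cong: if_cong)
    with False show ?thesis by (meson linear)
  qed
qed

theorem theorem5:
  fixes A :: "'a set" and M :: "'a set set"
  assumes "finite A" and "A \<noteq> {}"
    and "independence_system A M"
    and "\<forall>a\<in>A. \<exists>m\<in>M. a \<in> m"
  shows "uniform_fairness A M = rawlsian_justice A M"
proof (rule antisym)
  show "uniform_fairness A M \<le> rawlsian_justice A M"
    unfolding uniform_fairness_def rawlsian_justice_def
    by (rule SUP_subset_mono) (auto simp: uniform_feasible_def rawlsian_feasible_def)
  show "rawlsian_justice A M \<le> uniform_fairness A M"
    unfolding uniform_fairness_def rawlsian_justice_def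
    by (rule SUP_mono)
      (force dest!: uniform_dominates_rawlsian[OF assms(1,3)] simp: split_beta)
qed

end
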